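(* A poset $\mathbb{P}$ is productively ccc if and only if $\mathscr{F}(\mathscr{A})$ is not ccc for all $\mathscr{A}\in\mathcal{L}_{\aleph_0}(\mathbb{P})$.
   Context: A poset $(\mathbb{P},\leq)$ is a set with a preorder (a reflexive and transitive relation; antisymmetry is not required). Elements $p,q\in\mathbb{P}$ are compatible if there is $r\in\mathbb{P}$ with $r\leq p$ and $r\leq q$, and incompatible otherwise. An antichain of $\mathbb{P}$ is a subset of pairwise incompatible elements (i.e. any two distinct elements are incompatible). A poset is ccc if all its antichains are countable. The product $\mathbb{P}\times\mathbb{Q}$ of posets carries the coordinatewise preorder. A poset $\mathbb{P}$ is productively ccc if $\mathbb{P}\times\mathbb{Q}$ is ccc for every ccc poset $\mathbb{Q}$. $\mathcal{L}_{\aleph_0}(\mathbb{P})$ is the collection of all families $\mathscr{A}$ of antichains of $\mathbb{P}$ such that $\bigcup\mathscr{A}$ is uncountable, i.e. $\left|\bigcup\mathscr{A}\right|\geq\aleph_1$. For such $\mathscr{A}$, $\mathscr{F}(\mathscr{A})=\bigcup_{\mathcal{A}\in\mathscr{A}}[\mathcal{A}]^{<\aleph_0}$ is the set of all finite subsets of members of $\mathscr{A}$, partially ordered by reverse inclusion ($R\leq P$ iff $P\subseteq R$). *)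

theory Defs
  imports "HOL-Library.Countable_Set"
begin

text \<open>
  A poset is a carrier set \<^term>\<open>P\<close> with a relation \<^term>\<open>r\<close> such that
  \<^term>\<open>preorder_on P r\<close>; antisymmetry is not required.
  \<^term>\<open>(p, q) \<in> r\<close> is read as \<open>p \<le> q\<close>.
\<close>

definition compatible :: "'a set \<Rightarrow> 'a rel \<Rightarrow> 'a \<Rightarrow> 'a \<Rightarrow> bool" where
  "compatible P r p q \<longleftrightarrow> (\<exists>s\<in>P. (s, p) \<in> r \<and> (s, q) \<in> r)"

definition antichain :: "'a set \<Rightarrow> 'a rel \<Rightarrow> 'a set \<Rightarrow> bool" where
  "antichain P r A \<longleftrightarrow> A \<subseteq> P \<and> (\<forall>p\<in>A. \<forall>q\<in>A. p \<noteq> q \<longrightarrow> \<not> compatible P r p q)"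

definition ccc :: "'a set \<Rightarrow> 'a rel \<Rightarrow> bool" where
  "ccc P r \<longleftrightarrow> (\<forall>A. antichain P r A \<longrightarrow> countable A)"

definition prod_order :: "'a rel \<Rightarrow> 'b rel \<Rightarrow> ('a \<times> 'b) rel" where
  "prod_order r s = {((p, q), (p', q')). (p, p') \<in> r \<and> (q, q') \<in> s}"

text \<open>
  HOL cannot quantify over types inside a formula, so the type carrying the posets
  \<^term>\<open>Q\<close> is a parameter. It plays the role of a universe: the notion is meaningful
  only when this type is large enough or arbitrarily large. \<^term>\<open>Q\<close> itself is any
  subset of that type with any preorder on it.
\<close>

definition productively_ccc :: "'q itself \<Rightarrow> 'a set \<Rightarrow> 'a rel \<Rightarrow> bool" where
  "productively_ccc U P r \<longleftrightarrow>
     (\<forall>(Q :: 'q set) s. preorder_on Q s \<longrightarrow> ccc Q s \<longrightarrow> ccc (P \<times> Q) (prod_order r s))"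

definition large_antichain_families :: "'a set \<Rightarrow> 'a rel \<Rightarrow> 'a set set set" where
  "large_antichain_families P r =
     {\<A>. (\<forall>A\<in>\<A>. antichain P r A) \<and> uncountable (\<Union>\<A>)}"

definition finite_parts :: "'a set set \<Rightarrow> 'a set set" where
  "finite_parts \<A> = (\<Union>A\<in>\<A>. Fpow A)"

definition reverse_inclusion :: "'a set set \<Rightarrow> 'a set rel" where
  "reverse_inclusion \<F> = {(R, S). R \<in> \<F> \<and> S \<in> \<F> \<and> S \<subseteq> R}"

end

theory Submission
  imports Defs
begin

text \<open>
  If \<open>\<F>(\<A>)\<close> is ccc, its product with \<open>P\<close> is not, because the pairs \<open>(p, {p})\<close> with
  \<open>p \<in> \<Union>\<A>\<close> form an antichain: a lower bound of two of them would put two compatible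
  elements into one member of \<open>\<A>\<close>. Conversely, from an uncountable antichain \<open>W\<close> of
  \<open>P \<times> Q\<close> with \<open>Q\<close> ccc, select for each \<open>p\<close> in the first projection \<open>D\<close> of \<open>W\<close> some \<open>f p\<close>
  with \<open>(p, f p) \<in> W\<close>; \<open>D\<close> is uncountable since the fibres of \<open>W\<close> are antichains of \<open>Q\<close>.
  Let \<open>\<A>\<close> consist of the finite \<open>A \<subseteq> D\<close> such that \<open>f ` A\<close> has a lower bound in \<open>Q\<close>. These
  are antichains of \<open>P\<close>, and mapping each to such a lower bound preserves incompatibility,
  so \<open>\<F>(\<A>) = \<A>\<close> inherits ccc from \<open>Q\<close>.
\<close>

text \<open>On an antichain \<open>t\<close> is injective: if \<open>t p = t p'\<close>, then
  \<open>t p\<close> is by reflexivity a common lower bound of both images, so \<open>p\<close> and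
  \<open>p'\<close> are compatible and hence equal.\<close>

lemma ccc_if_incompatibility_preserving:
  assumes "ccc Q s" and refl: "\<And>q. q \<in> Q \<Longrightarrow> (q, q) \<in> s"
    and into: "\<And>p. p \<in> P \<Longrightarrow> t p \<in> Q"
    and comp: "\<And>p p'. p \<in> P \<Longrightarrow> p' \<in> P \<Longrightarrow> compatible Q s (t p) (t p') \<Longrightarrow> compatible P r p p'"
  shows "ccc P r"
  unfolding ccc_def
proof (intro allI impI)
  fix A assume A: "antichain P r A"
  have eq: "p = p'" if "p \<in> A" "p' \<in> A" "compatible Q s (t p) (t p')" for p p'
    using that A comp unfolding antichain_def by (metis subsetD)
  have "antichain Q s (t ` A)"
    using A into eq unfolding antichain_def by blast
  then have "countable (t ` A)"
    using \<open>ccc Q s\<close> unfolding ccc_def by blast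
  moreover have "inj_on t A"
  proof (rule inj_onI)
    fix p p' assume pp: "p \<in> A" "p' \<in> A" "t p = t p'"
    have "t p \<in> Q" using A into pp unfolding antichain_def by blast
    then have "compatible Q s (t p) (t p')"
      using refl pp unfolding compatible_def by metis
    then show "p = p'" using eq pp by blast
  qed
  ultimately show "countable A" by (rule countable_image_inj_on)
qed

lemma uncountable_singleton_antichain:
  assumes "\<A> \<in> large_antichain_families P r"
  shows "\<not> ccc (P \<times> finite_parts \<A>) (prod_order r (reverse_inclusion (finite_parts \<A>)))"
proof
  let ?W = "(\<lambda>p. (p, {p})) ` \<Union>\<A>"
  have anti: "\<And>A. A \<in> \<A> \<Longrightarrow> antichain P r A" and unc: "uncountable (\<Union>\<A>)"
    using assms unfolding large_antichain_families_def by auto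
  assume "ccc (P \<times> finite_parts \<A>) (prod_order r (reverse_inclusion (finite_parts \<A>)))"
  moreover have "antichain (P \<times> finite_parts \<A>)
      (prod_order r (reverse_inclusion (finite_parts \<A>))) ?W"
    unfolding antichain_def
  proof (intro conjI ballI impI notI)
    show "?W \<subseteq> P \<times> finite_parts \<A>"
      using anti unfolding antichain_def finite_parts_def Fpow_def by fastforce
  next
    fix x y assume "x \<in> ?W" "y \<in> ?W" and xy: "x \<noteq> y"
      and c: "compatible (P \<times> finite_parts \<A>)
        (prod_order r (reverse_inclusion (finite_parts \<A>))) x y"
    then obtain p q where pq: "x = (p, {p})" "y = (q, {q})" by blast
    then obtain u R where u: "u \<in> P" "(u, p) \<in> r" "(u, q) \<in> r"
      and R: "R \<in> finite_parts \<A>" "p \<in> R" "q \<in> R"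
      using c unfolding compatible_def prod_order_def reverse_inclusion_def by auto
    then obtain A where "A \<in> \<A>" "p \<in> A" "q \<in> A"
      unfolding finite_parts_def Fpow_def by blast
    then have "\<not> compatible P r p q"
      using anti xy pq unfolding antichain_def by blast
    then show False using u unfolding compatible_def by blast
  qed
  ultimately have "countable ?W" unfolding ccc_def by blast
  moreover have "inj_on (\<lambda>p. (p, {p})) (\<Union>\<A>)" by (simp add: inj_on_def)
  ultimately show False using unc countable_image_inj_on by blast
qed

text \<open>Brings posets from outside the universe \<open>'q\<close> into reach. \<open>Q\<close>
  is copied along \<open>\<phi>\<close>; ccc passes to the copy through \<open>inv \<phi>\<close>,
  and ccc of the product comes back through \<open>map_prod id \<phi>\<close>.\<close>

lemma productively_ccc_transfer:
  fixes \<phi> :: "'b \<Rightarrow> 'q" and Q :: "'b set"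
  assumes "inj \<phi>" and prod: "productively_ccc TYPE('q) P r"
    and r: "preorder_on P r" and s: "preorder_on Q s" and "ccc Q s"
  shows "ccc (P \<times> Q) (prod_order r s)"
proof -
  let ?s = "map_prod \<phi> \<phi> ` s"
  have s_iff: "(\<phi> a, \<phi> b) \<in> ?s \<longleftrightarrow> (a, b) \<in> s" for a b
  proof
    assume "(\<phi> a, \<phi> b) \<in> ?s"
    then show "(a, b) \<in> s" using \<open>inj \<phi>\<close> by (auto simp: inj_eq)
  next
    assume "(a, b) \<in> s"
    then show "(\<phi> a, \<phi> b) \<in> ?s" by (rule rev_image_eqI) simp
  qed
  have s_sub: "s \<subseteq> Q \<times> Q" and s_refl: "\<And>q. q \<in> Q \<Longrightarrow> (q, q) \<in> s" and s_trans: "trans s"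
    using s unfolding preorder_on_def refl_on_def by auto
  have r_refl: "\<And>p. p \<in> P \<Longrightarrow> (p, p) \<in> r"
    using r unfolding preorder_on_def refl_on_def by auto
  have "preorder_on (\<phi> ` Q) ?s"
    unfolding preorder_on_def
  proof (intro conjI)
    show "?s \<subseteq> \<phi> ` Q \<times> \<phi> ` Q" using s_sub by auto
    show "refl_on (\<phi> ` Q) ?s"
      using s_refl s_iff unfolding refl_on_def by auto
    show "trans ?s"
    proof (rule transI)
      fix x y z assume "(x, y) \<in> ?s" "(y, z) \<in> ?s"
      then obtain a b c where "x = \<phi> a" "y = \<phi> b" "z = \<phi> c" "(a, b) \<in> s" "(b, c) \<in> s"
        using \<open>inj \<phi>\<close> by (auto simp: inj_eq)
      then show "(x, z) \<in> ?s" using s_trans s_iff by (metis transD)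
    qed
  qed
  moreover have "ccc (\<phi> ` Q) ?s"
  proof (rule ccc_if_incompatibility_preserving[OF \<open>ccc Q s\<close> s_refl])
    show "inv \<phi> p \<in> Q" if "p \<in> \<phi> ` Q" for p
      using that \<open>inj \<phi>\<close> by auto
    show "compatible (\<phi> ` Q) ?s p p'"
      if "p \<in> \<phi> ` Q" "p' \<in> \<phi> ` Q" "compatible Q s (inv \<phi> p) (inv \<phi> p')" for p p'
      using that \<open>inj \<phi>\<close> s_iff unfolding compatible_def by (auto simp del: map_prod_simp)
  qed
  ultimately have "ccc (P \<times> \<phi> ` Q) (prod_order r ?s)"
    using prod unfolding productively_ccc_def by blast
  then show ?thesis
  proof (rule ccc_if_incompatibility_preserving)
    show "(x, x) \<in> prod_order r ?s" if "x \<in> P \<times> \<phi> ` Q" for x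
      using that r_refl s_refl s_iff unfolding prod_order_def by auto
    show "map_prod id \<phi> x \<in> P \<times> \<phi> ` Q" if "x \<in> P \<times> Q" for x
      using that by auto
    show "compatible (P \<times> Q) (prod_order r s) x y"
      if c: "compatible (P \<times> \<phi> ` Q) (prod_order r ?s) (map_prod id \<phi> x) (map_prod id \<phi> y)" for x y
    proof -
      obtain p q p' q' where xy: "x = (p, q)" "y = (p', q')" by (cases x; cases y)
      then obtain u v where "u \<in> P" "v \<in> Q" "(u, p) \<in> r" "(u, p') \<in> r"
        "(v, q) \<in> s" "(v, q') \<in> s"
        using c s_iff unfolding compatible_def prod_order_def by auto
      then have "(u, v) \<in> P \<times> Q" "((u, v), x) \<in> prod_order r s" "((u, v), y) \<in> prod_order r s"
        using xy unfolding prod_order_def by auto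
      then show ?thesis unfolding compatible_def by blast
    qed
  qed
qed

lemma preorder_on_reverse_inclusion: "preorder_on \<F> (reverse_inclusion \<F>)"
  unfolding preorder_on_def refl_on_def trans_def reverse_inclusion_def by auto

text \<open>If \<open>v\<close> is a lower bound of two points \<open>q\<close>, \<open>q'\<close>
  in the fibre over \<open>p\<close>, then \<open>(p, v)\<close> lies below \<open>(p, q)\<close>
  and \<open>(p, q')\<close>. So fibres are antichains of \<open>Q\<close>, and countably many of
  them cannot cover \<open>W\<close>.\<close>

lemma uncountable_fst_antichain_prod:
  assumes refl: "\<And>p. p \<in> P \<Longrightarrow> (p, p) \<in> r" and "ccc Q s"
    and W: "antichain (P \<times> Q) (prod_order r s) W" and unc: "uncountable W"
  shows "uncountable (fst ` W)"
proof
  assume "countable (fst ` W)"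
  moreover have "countable {q. (p, q) \<in> W}" if "p \<in> fst ` W" for p
  proof -
    have "p \<in> P" using that W unfolding antichain_def by auto
    have "antichain Q s {q. (p, q) \<in> W}"
      unfolding antichain_def
    proof (intro conjI ballI impI notI)
      show "{q. (p, q) \<in> W} \<subseteq> Q" using W unfolding antichain_def by auto
      fix q q' assume "q \<in> {q. (p, q) \<in> W}" "q' \<in> {q. (p, q) \<in> W}" "q \<noteq> q'"
        and c: "compatible Q s q q'"
      then have "\<not> compatible (P \<times> Q) (prod_order r s) (p, q) (p, q')"
        using W unfolding antichain_def by auto
      then show False
        using c refl[OF \<open>p \<in> P\<close>] \<open>p \<in> P\<close> unfolding compatible_def prod_order_def by auto
    qed
    then show ?thesis using \<open>ccc Q s\<close> unfolding ccc_def by blast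
  qed
  ultimately have "countable (SIGMA p : fst ` W. {q. (p, q) \<in> W})"
    by (rule countable_SIGMA)
  moreover have "W \<subseteq> (SIGMA p : fst ` W. {q. (p, q) \<in> W})" by force
  ultimately show False using unc countable_subset by blast
qed

lemma large_family_of_antichain_prod:
  assumes r: "preorder_on P r" and s: "preorder_on Q s" and "ccc Q s"
    and W: "antichain (P \<times> Q) (prod_order r s) W" and unc: "uncountable W"
  shows "\<exists>\<A> \<in> large_antichain_families P r.
    ccc (finite_parts \<A>) (reverse_inclusion (finite_parts \<A>))"
proof -
  have r_refl: "\<And>p. p \<in> P \<Longrightarrow> (p, p) \<in> r"
    using r unfolding preorder_on_def refl_on_def by auto
  have s_refl: "\<And>q. q \<in> Q \<Longrightarrow> (q, q) \<in> s" and s_trans: "trans s"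
    using s unfolding preorder_on_def refl_on_def by auto
  define D where "D = fst ` W"
  have "uncountable D"
    unfolding D_def by (rule uncountable_fst_antichain_prod[OF r_refl \<open>ccc Q s\<close> W unc])
  have "\<forall>p\<in>D. \<exists>q. (p, q) \<in> W" unfolding D_def by force
  then obtain f where f: "\<And>p. p \<in> D \<Longrightarrow> (p, f p) \<in> W" by metis
  have DQ: "p \<in> P \<and> f p \<in> Q" if "p \<in> D" for p
    using f[OF that] W unfolding antichain_def by auto
  define \<A> where "\<A> = {A. finite A \<and> A \<subseteq> D \<and> (\<exists>t\<in>Q. \<forall>p\<in>A. (t, f p) \<in> s)}"
  have anti: "antichain P r A" if A: "A \<in> \<A>" for A
    unfolding antichain_def
  proof (intro conjI ballI impI notI)
    show "A \<subseteq> P" using that DQ unfolding \<A>_def by auto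
    fix p q assume pq: "p \<in> A" "q \<in> A" "p \<noteq> q" and c: "compatible P r p q"
    then have "p \<in> D" "q \<in> D" using that unfolding \<A>_def by auto
    \<comment> \<open>The second coordinates do have a lower bound, since \<open>A\<close> is in
      \<open>\<A>\<close>, so the incompatibility must come from \<open>p\<close> and
      \<open>q\<close>.\<close>
    then have "\<not> compatible (P \<times> Q) (prod_order r s) (p, f p) (q, f q)"
      using f \<open>p \<noteq> q\<close> W unfolding antichain_def by blast
    moreover obtain t where "t \<in> Q" "(t, f p) \<in> s" "(t, f q) \<in> s"
      using A pq unfolding \<A>_def by auto
    ultimately show False
      using c unfolding compatible_def prod_order_def by auto
  qed
  have "\<forall>A\<in>\<A>. \<exists>t. t \<in> Q \<and> (\<forall>p\<in>A. (t, f p) \<in> s)" unfolding \<A>_def by auto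
  then obtain t where t: "\<And>A. A \<in> \<A> \<Longrightarrow> t A \<in> Q"
    and t_le: "\<And>A p. A \<in> \<A> \<Longrightarrow> p \<in> A \<Longrightarrow> (t A, f p) \<in> s"
    by metis
  \<comment> \<open>The lower bound required in \<open>Q\<close> is \<open>f p\<close>
    itself.\<close>
  have "{p} \<in> \<A>" if "p \<in> D" for p
    using that DQ s_refl unfolding \<A>_def by auto
  then have "D \<subseteq> \<Union>\<A>" by blast
  then have "\<A> \<in> large_antichain_families P r"
    using anti \<open>uncountable D\<close> countable_subset
    unfolding large_antichain_families_def by blast
  \<comment> \<open>Members are finite, and a subset of a member keeps its lower bound.\<close>
  moreover have "finite_parts \<A> = \<A>"
    unfolding finite_parts_def Fpow_def \<A>_def by blast
  moreover have "ccc \<A> (reverse_inclusion \<A>)"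
  proof (rule ccc_if_incompatibility_preserving[OF \<open>ccc Q s\<close> s_refl t])
    fix A B assume AB: "A \<in> \<A>" "B \<in> \<A>" and "compatible Q s (t A) (t B)"
    then obtain u where u: "u \<in> Q" "(u, t A) \<in> s" "(u, t B) \<in> s"
      unfolding compatible_def by blast
    \<comment> \<open>By transitivity \<open>u\<close> witnesses that \<open>A \<union> B\<close> is
      in \<open>\<A>\<close>, where it is a common lower bound of \<open>A\<close> and
      \<open>B\<close>.\<close>
    then have "\<forall>p\<in>A \<union> B. (u, f p) \<in> s"
      using AB t_le s_trans by (metis Un_iff transD)
    then have "A \<union> B \<in> \<A>" using AB u unfolding \<A>_def by auto
    then show "compatible \<A> (reverse_inclusion \<A>) A B"
      using AB unfolding compatible_def reverse_inclusion_def by auto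
  qed
  ultimately show ?thesis by metis
qed

(* 'u is an arbitrary type, so every type 'u is covered through its copy in 'a set + 'u;
   the summand 'a set only ensures that the universe is not too small for the given P. *)
theorem corollary2p3:
  fixes P :: "'a set" and r :: "'a rel"
  assumes "preorder_on P r"
  shows "productively_ccc TYPE('a set + 'u) P r \<longleftrightarrow>
    (\<forall>\<A> \<in> large_antichain_families P r.
       \<not> ccc (finite_parts \<A>) (reverse_inclusion (finite_parts \<A>)))"
proof
  assume prod: "productively_ccc TYPE('a set + 'u) P r"
  show "\<forall>\<A> \<in> large_antichain_families P r.
      \<not> ccc (finite_parts \<A>) (reverse_inclusion (finite_parts \<A>))"
    \<comment> \<open>\<open>\<F>(\<A>)\<close> lives on the type \<open>'a set\<close>, which
      \<open>Inl\<close> embeds into the universe.\<close>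
    using productively_ccc_transfer[OF inj_Inl prod assms preorder_on_reverse_inclusion]
      uncountable_singleton_antichain by blast
next
  assume "\<forall>\<A> \<in> large_antichain_families P r.
      \<not> ccc (finite_parts \<A>) (reverse_inclusion (finite_parts \<A>))"
  then show "productively_ccc TYPE('a set + 'u) P r"
    using large_family_of_antichain_prod[OF assms]
    \<comment> \<open>Only ccc of the product is unfolded: its failure supplies the uncountable
      antichain \<open>W\<close>.\<close>
    unfolding productively_ccc_def ccc_def[of "P \<times> _"] by blast
qed

end
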